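(* For every $f\in\mathcal F$, all $x>0$ and all integers $n,i,j\ge0$, $$(E_nf)(x)=\left(\frac{x}{x_0}\right)^n f(q^nx),$$ and hence $$\mathcal L_{x_0}(E_nf)=f(q^nx_0).$$ Moreover, $$q^{-ij}\,\mathcal L_{x_0}(E_iE_jf)=f(q^{i+j}x_0).$$
   Context: Fix $x_0>0$ and $q\in(0,1)$. Let $\mathcal F$ be a linear space of pointwise-defined complex-valued functions on $\mathbb R_+=(0,\infty)$ that is invariant under the operators $(T_qf)(x)=f(qx)$ and $(\mathsf X_{x_0}f)(x)=\frac{x}{x_0}f(x)$. Put $\mathcal L_{x_0}(g)=g(x_0)$ for $g\in\mathcal F$, and $E_n=\mathsf X_{x_0}^nT_q^n$ for $n\ge0$. *)

theory Defs
  imports Complex_Main "HOL-Library.FuncSet"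
begin

text \<open>
  A complex-valued function on \<open>(0,\<infinity>)\<close> is represented by an \<^term>\<open>extensional\<close> function on
  \<^term>\<open>{0<..} :: real set\<close>, so that equality in HOL is pointwise equality on \<open>(0,\<infinity>)\<close>.
\<close>

definition linear_function_space :: "(real \<Rightarrow> complex) set \<Rightarrow> bool" where
  "linear_function_space F \<longleftrightarrow>
     F \<subseteq> extensional {0<..} \<and>
     (\<lambda>x\<in>{0<..}. 0) \<in> F \<and>
     (\<forall>f\<in>F. \<forall>g\<in>F. (\<lambda>x\<in>{0<..}. f x + g x) \<in> F) \<and>
     (\<forall>c. \<forall>f\<in>F. (\<lambda>x\<in>{0<..}. c * f x) \<in> F)"

definition dilation :: "real \<Rightarrow> (real \<Rightarrow> complex) \<Rightarrow> real \<Rightarrow> complex" where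
  "dilation q f = (\<lambda>x\<in>{0<..}. f (q * x))"

definition mult_op :: "real \<Rightarrow> (real \<Rightarrow> complex) \<Rightarrow> real \<Rightarrow> complex" where
  "mult_op x0 f = (\<lambda>x\<in>{0<..}. of_real (x / x0) * f x)"

text \<open>
  The evaluation functional has domain \<open>F\<close>: outside \<open>F\<close> its value is \<^term>\<open>undefined\<close>, so an
  equation for its value at \<open>g\<close> is only provable where \<open>g \<in> F\<close>.
\<close>

definition eval_at :: "(real \<Rightarrow> complex) set \<Rightarrow> real \<Rightarrow> (real \<Rightarrow> complex) \<Rightarrow> complex" where
  "eval_at F x0 = (\<lambda>g\<in>F. g x0)"

definition E_op :: "real \<Rightarrow> real \<Rightarrow> nat \<Rightarrow> (real \<Rightarrow> complex) \<Rightarrow> real \<Rightarrow> complex" where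
  "E_op x0 q n = (mult_op x0 ^^ n) \<circ> (dilation q ^^ n)"

end

theory Submission
  imports Defs
begin

text \<open>
  Iterating the dilation \<open>n\<close> times replaces the argument by \<open>q\<^sup>n x\<close>, and iterating the
  multiplication operator \<open>n\<close> times contributes the factor \<open>(x / x\<^sub>0)\<^sup>n\<close>; since \<open>q > 0\<close>, every
  point met on the way stays in \<open>(0,\<infinity>)\<close>. Composing the two gives the pointwise formula for
  \<open>E\<^sub>n\<close>. At \<open>x = x\<^sub>0\<close> the factor becomes \<open>1\<close>, so there \<open>E\<^sub>n\<close> simply samples \<open>f\<close> at \<open>q\<^sup>n x\<^sub>0\<close>.

  The product \<open>E\<^sub>i E\<^sub>j\<close> differs in general from \<open>E\<^sub>i\<^sub>+\<^sub>j\<close>, because multiplication and dilation commute only up to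
  a power of \<open>q\<close>. At \<open>x\<^sub>0\<close> the outer \<open>E\<^sub>i\<close> samples \<open>E\<^sub>j f\<close> at \<open>q\<^sup>i x\<^sub>0\<close>, where the weight of
  \<open>E\<^sub>j\<close> is \<open>(q\<^sup>i)\<^sup>j\<close>; this is the factor that \<open>q\<^sup>-\<^sup>i\<^sup>j\<close> cancels. Invariance of the space
  ensures that the evaluation functional is applied inside its domain.
\<close>

lemma dilation_funpow_apply:
  assumes "q > 0" and "x > 0"
  shows "(dilation q ^^ n) f x = f (q ^ n * x)"
  using \<open>x > 0\<close>
proof (induction n arbitrary: x)
  case 0
  then show ?case by simp
next
  case (Suc n)
  then show ?case
    using \<open>q > 0\<close> by (simp add: dilation_def mult_ac)
qed

lemma mult_op_funpow_apply:
  assumes "x > 0"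
  shows "(mult_op x0 ^^ n) f x = of_real ((x / x0) ^ n) * f x"
  using assms by (induction n) (simp_all add: mult_op_def mult_ac)

lemma E_op_apply:
  assumes "q > 0" and "x > 0"
  shows "E_op x0 q n f x = of_real ((x / x0) ^ n) * f (q ^ n * x)"
  using assms by (simp add: E_op_def mult_op_funpow_apply dilation_funpow_apply)

lemma funpow_closed:
  assumes "\<And>f. f \<in> F \<Longrightarrow> T f \<in> F" and "f \<in> F"
  shows "(T ^^ n) f \<in> F"
  using assms by (induction n) auto

lemma E_op_closed:
  assumes "\<And>f. f \<in> F \<Longrightarrow> dilation q f \<in> F"
    and "\<And>f. f \<in> F \<Longrightarrow> mult_op x0 f \<in> F"
    and "f \<in> F"
  shows "E_op x0 q n f \<in> F"
  using assms by (simp add: E_op_def funpow_closed)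

theorem proposition2p5:
  fixes x0 q :: real and F :: "(real \<Rightarrow> complex) set"
  assumes "x0 > 0" and "0 < q" and "q < 1"
    and "linear_function_space F"
    and "\<And>f. f \<in> F \<Longrightarrow> dilation q f \<in> F"
    and "\<And>f. f \<in> F \<Longrightarrow> mult_op x0 f \<in> F"
  shows "\<forall>f\<in>F. \<forall>x>0. \<forall>n i j :: nat.
           E_op x0 q n f x = of_real ((x / x0) ^ n) * f (q ^ n * x) \<and>
           eval_at F x0 (E_op x0 q n f) = f (q ^ n * x0) \<and>
           of_real (q powi (- int (i * j))) * eval_at F x0 (E_op x0 q i (E_op x0 q j f))
             = f (q ^ (i + j) * x0)"
proof (intro ballI allI impI)
  fix f and x :: real and n i j :: nat
  assume f: "f \<in> F" and x: "x > 0"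
  have closed: "E_op x0 q m g \<in> F" if "g \<in> F" for m g
    using E_op_closed assms(5,6) that by blast
  have eval: "eval_at F x0 (E_op x0 q m g) = g (q ^ m * x0)" if "g \<in> F" for m g
    using closed[OF that] assms(1,2) by (simp add: eval_at_def E_op_apply)
  have "eval_at F x0 (E_op x0 q i (E_op x0 q j f)) = E_op x0 q j f (q ^ i * x0)"
    using eval closed f by blast
  also have "\<dots> = of_real (q ^ (i * j)) * f (q ^ (i + j) * x0)"
    using assms(1,2) by (simp add: E_op_apply power_mult power_add mult_ac)
  finally have composed: "eval_at F x0 (E_op x0 q i (E_op x0 q j f))
      = of_real (q ^ (i * j)) * f (q ^ (i + j) * x0)" .
  have cancel: "q powi (- int (i * j)) * q ^ (i * j) = 1"
    using assms(2) by (simp add: power_int_minus flip: of_nat_mult)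
  have "of_real (q powi (- int (i * j))) * eval_at F x0 (E_op x0 q i (E_op x0 q j f))
      = of_real (q powi (- int (i * j)) * q ^ (i * j)) * f (q ^ (i + j) * x0)"
    unfolding composed of_real_mult by (rule mult.assoc[symmetric])
  also have "\<dots> = f (q ^ (i + j) * x0)"
    unfolding cancel by simp
  finally show "E_op x0 q n f x = of_real ((x / x0) ^ n) * f (q ^ n * x) \<and>
      eval_at F x0 (E_op x0 q n f) = f (q ^ n * x0) \<and>
      of_real (q powi (- int (i * j))) * eval_at F x0 (E_op x0 q i (E_op x0 q j f))
        = f (q ^ (i + j) * x0)"
    using E_op_apply[OF assms(2) x] eval[OF f] by blast
qed

end
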